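(* Let $n\ge 2$ and let $SG_n=\mathrm{Cay}(S_n,\{(1\,2),(1\,3),\dots,(1\,n)\})$ be the star graph. Then $SG_n$ has an induced subgraph on more than half of its vertices with maximum degree equal to $1$. In other words, $\sigma(SG_n)=1$.
   Context: For a group $\Gamma$ and $C\subseteq\Gamma$, $\mathrm{Cay}(\Gamma,C)$ is the simple undirected graph on $\Gamma$ in which $\{x,y\}$ is an edge iff $x^{-1}y\in C$. For a graph $G=(V,E)$, $\alpha(G)$ is its independence number and the sensitivity $\sigma(G)$ is the minimum of the maximum degree of $G[K]$ over all $K\subseteq V$ with $|K|>\alpha(G)$. The star graph is bipartite and regular, so $\alpha(SG_n)=n!/2$. *)

theory Defs
  imports "HOL-Algebra.Sym_Groups" "HOL-Library.Ramsey"
begin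

record 'a sgraph =
  verts :: "'a set"
  edges :: "'a set set"

definition induced_subgraph :: "'a sgraph \<Rightarrow> 'a set \<Rightarrow> 'a sgraph" where
  "induced_subgraph G K = \<lparr>verts = K, edges = {e \<in> edges G. e \<subseteq> K}\<rparr>"

definition vdegree :: "'a sgraph \<Rightarrow> 'a \<Rightarrow> nat" where
  "vdegree G v = card {w \<in> verts G. {v, w} \<in> edges G}"

text \<open>For finite graphs with at least one vertex.\<close>
definition max_degree :: "'a sgraph \<Rightarrow> nat" where
  "max_degree G = Max (vdegree G ` verts G)"

text \<open>For finite graphs; \<open>indep\<close> is the predicate of \<open>HOL-Library.Ramsey\<close>.\<close>
definition independence_number :: "'a sgraph \<Rightarrow> nat" where
  "independence_number G = Max {card I |I. I \<subseteq> verts G \<and> indep I (edges G)}"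

text \<open>For finite graphs with at least one edge: the minimum is then over a nonempty finite set,
  and every \<open>K\<close> that occurs is nonempty.\<close>
definition sensitivity :: "'a sgraph \<Rightarrow> nat" where
  "sensitivity G =
     Min {max_degree (induced_subgraph G K) |K. K \<subseteq> verts G \<and> card K > independence_number G}"

text \<open>Edges are unordered, so this is \<open>{x, y}\<close> is an edge iff \<open>inv x \<otimes> y \<in> C\<close> for connection sets
  closed under inverses and not containing the unit; see \<open>cayley_edge_iff\<close> below.\<close>
definition cayley_graph :: "('a, 'b) monoid_scheme \<Rightarrow> 'a set \<Rightarrow> 'a sgraph" where
  "cayley_graph \<Gamma> C =
     \<lparr>verts = carrier \<Gamma>,
      edges = {{x, y} |x y. x \<in> carrier \<Gamma> \<and> y \<in> carrier \<Gamma> \<and> x \<noteq> y \<and> inv\<^bsub>\<Gamma>\<^esub> x \<otimes>\<^bsub>\<Gamma>\<^esub> y \<in> C}\<rparr>"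

lemma (in group) cayley_edge_iff:
  assumes inv_closed: "\<And>c. c \<in> C \<Longrightarrow> inv c \<in> C" and no_unit: "\<one> \<notin> C"
    and xy: "x \<in> carrier G" "y \<in> carrier G"
  shows "{x, y} \<in> edges (cayley_graph G C) \<longleftrightarrow> inv x \<otimes> y \<in> C"
proof -
  have inv_eq: "inv (inv u \<otimes> v) = inv v \<otimes> u" if "u \<in> carrier G" "v \<in> carrier G" for u v
    using that by (simp add: inv_mult_group)
  have sym: "inv v \<otimes> u \<in> C" if "u \<in> carrier G" "v \<in> carrier G" "inv u \<otimes> v \<in> C" for u v
    using inv_closed[OF that(3)] inv_eq[OF that(1,2)] by simp
  have "x \<noteq> y" if "inv x \<otimes> y \<in> C"
    using that no_unit xy by auto
  then show ?thesis
    using xy sym by (auto simp: cayley_graph_def doubleton_eq_iff)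
qed

definition star_graph :: "nat \<Rightarrow> (nat \<Rightarrow> nat) sgraph" where
  "star_graph n = cayley_graph (sym_group n) {transpose 1 i |i. i \<in> {2..n}}"

end

(* Let H be the set of permutations with a fixed point other than 1.  The set K takes the
   permutations of one sign outside H and those of the opposite sign inside H.  An edge of K joins
   x in H to y = x (1 i) outside H, so i is the only fixed point of x other than 1, and i = y(1):
   each endpoint determines the other, and K has maximum degree at most 1.  By inclusion-exclusion
   over the fixed points, the signs of the permutations outside H sum to (-1)^(n-1), whence K and
   its complement differ in size by 2.  The perfect matching x -- x (1 2) bounds independent sets
   by n!/2. *)
theory Submission
  imports Defs
begin

section \<open>Signed sums over permutations\<close>

lemma sum_sign_permutes:
  assumes fin: "finite A" and card: "card A \<ge> 2"
  shows "(\<Sum>p | p permutes A. sign p) = 0"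
proof -
  obtain a b where ab: "a \<in> A" "b \<in> A" "a \<noteq> b"
    using card by (metis One_nat_def card.infinite card_le_Suc0_iff_eq fin not_less_eq_eq numeral_2_eq_2)
  \<comment> \<open>Left multiplication by a transposition is a sign-reversing involution, so the
    sum equals its own negative.\<close>
  have "(\<Sum>p | p permutes A. sign p) = (\<Sum>p | p permutes A. sign (transpose a b \<circ> p))"
    by (rule sum.reindex_bij_witness
        [of _ "\<lambda>p. transpose a b \<circ> p" "\<lambda>p. transpose a b \<circ> p"])
      (auto simp: comp_assoc[symmetric] intro!: permutes_compose permutes_swap_id ab)
  also have "\<dots> = (\<Sum>p | p permutes A. - sign p)"
    using ab sign_compose[OF permutation_swap_id[of a b] permutes_imp_permutation[OF fin]]
    by (intro sum.cong refl) (simp add: sign_swap_id)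
  finally show ?thesis
    by (simp add: sum_negf)
qed

lemma permutes_fixpoint_iff:
  assumes "t \<in> A"
  shows "p permutes A \<and> p t = t \<longleftrightarrow> p permutes (A - {t})"
proof
  assume p: "p permutes A \<and> p t = t"
  show "p permutes (A - {t})"
  proof (rule permutes_superset)
    show "p permutes A" using p by blast
    show "\<And>x. x \<in> A - (A - {t}) \<Longrightarrow> p x = x" using p by blast
  qed
next
  assume p: "p permutes (A - {t})"
  show "p permutes A \<and> p t = t"
    using permutes_subset[OF p Diff_subset] permutes_not_in[OF p, of t] by blast
qed

text \<open>Inclusion-exclusion, one point at a time. To forbid the fixed point \<open>t\<close> as
  well, subtract the permutations fixing \<open>t\<close>, which are permutations of
  \<open>A - {t}\<close>. The full term vanishes by induction because \<open>A - T\<close> still has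
  at least two points; the subtracted term has the same leftover set \<open>A - insert t T\<close>
  and contributes one factor -1.\<close>

lemma sum_sign_no_fixpoint:
  assumes "finite T" "finite A" "T \<subseteq> A" "card (A - T) \<ge> 1"
  shows "(\<Sum>p | p permutes A \<and> (\<forall>t\<in>T. p t \<noteq> t). sign p) =
    (if card (A - T) = 1 then (- 1) ^ card T else 0)"
  using assms
proof (induction T arbitrary: A rule: finite_induct)
  case empty
  show ?case
  \<comment> \<open>A single point admits only the identity; with two or more points the signs
    cancel.\<close>
  proof (cases "card A = 1")
    case True
    then obtain a where "A = {a}" by (auto simp: card_1_singleton_iff)
    then show ?thesis by simp
  next
    case False
    then show ?thesis using empty sum_sign_permutes[of A] by simp
  qed
next
  case (insert t T)
  let ?P = "\<lambda>A. {p. p permutes A \<and> (\<forall>t\<in>T. p t \<noteq> t)}"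
  have tA: "t \<in> A" and fin: "finite (?P A)" "finite (?P (A - {t}))"
    using insert.prems by (auto intro!: finite_subset[OF _ finite_permutations])
  have sub: "?P (A - {t}) \<subseteq> ?P A"
    using permutes_fixpoint_iff[OF tA] by auto
  have "{p. p permutes A \<and> (\<forall>s\<in>insert t T. p s \<noteq> s)} = ?P A - ?P (A - {t})"
    using permutes_fixpoint_iff[OF tA] by auto
  then have split: "(\<Sum>p | p permutes A \<and> (\<forall>s\<in>insert t T. p s \<noteq> s). sign p) =
      (\<Sum>p\<in>?P A. sign p) - (\<Sum>p\<in>?P (A - {t}). sign p)"
    using sum_diff[OF fin(1) sub, of sign] by simp
  have eq: "A - T = insert t (A - insert t T)" "A - {t} - T = A - insert t T"
    using tA insert.hyps by auto
  have c: "card (A - T) = Suc (card (A - insert t T))"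
    unfolding eq(1) using insert.prems by simp
  have ne1: "card (A - T) \<ge> 1" "card (A - T) \<noteq> 1"
    using c insert.prems(3) by linarith+
  have "T \<subseteq> A - {t}"
    using insert.prems insert.hyps by auto
  then have "(\<Sum>p\<in>?P (A - {t}). sign p) =
      (if card (A - insert t T) = 1 then (- 1) ^ card T else 0)"
    using insert.IH[of "A - {t}"] insert.prems unfolding eq(2) by simp
  moreover have "(\<Sum>p\<in>?P A. sign p) = 0"
    using insert.IH[of A] insert.prems(1,2) insert.prems(3)[simplified] ne1 by auto
  ultimately show ?case
    unfolding split using insert.hyps by simp
qed

section \<open>Adjacency, independence and sensitivity\<close>

lemma verts_star_graph: "verts (star_graph n) = {p. p permutes {1..n}}"
  by (simp add: star_graph_def cayley_graph_def sym_group_def)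

text \<open>Transpositions are self-inverse and differ from the identity, so the connection set
  meets the conditions of \<open>cayley_edge_iff\<close>.\<close>

lemma star_graph_edge_iff:
  assumes x: "x permutes {1..n}" and y: "y permutes {1..n}"
  shows "{x, y} \<in> edges (star_graph n) \<longleftrightarrow> (\<exists>i\<in>{2..n}. y = x \<circ> transpose 1 i)"
proof -
  interpret G: group "sym_group n"
    by (rule sym_group_is_group)
  have t: "transpose 1 i \<in> carrier (sym_group n)" if "i \<in> {2..n}" for i
    using that by (auto simp: sym_group_carrier intro!: permutes_swap_id)
  have ne: "transpose 1 i \<noteq> id" if "i \<in> {2..n}" for i :: nat
    using that by (auto simp: fun_eq_iff transpose_def)
  have "{x, y} \<in> edges (star_graph n) \<longleftrightarrow>
      inv' x \<circ> y \<in> {transpose 1 i |i. i \<in> {2..n}}"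
    unfolding star_graph_def
    using x y t ne
    by (subst G.cayley_edge_iff) (force simp: sym_group_carrier sym_group_mult sym_group_one)+
  also have "\<dots> \<longleftrightarrow> (\<exists>i\<in>{2..n}. inv' x \<circ> y = transpose 1 i)"
    by auto
  also have "\<dots> \<longleftrightarrow> (\<exists>i\<in>{2..n}. y = x \<circ> transpose 1 i)"
    using permutes_inv_o[OF x] by (metis comp_assoc comp_id id_comp)
  finally show ?thesis .
qed

lemma max_degree_induced_ge_1:
  assumes "finite K" "\<not> indep K (edges G)"
  shows "max_degree (induced_subgraph G K) \<ge> 1"
proof -
  obtain v w where vw: "v \<in> K" "w \<in> K" "{v, w} \<in> edges G"
    using assms(2) by (auto simp: indep_def)
  have "finite {u \<in> K. {v, u} \<in> edges G \<and> {v, u} \<subseteq> K}"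
    using assms(1) by simp
  then have "vdegree (induced_subgraph G K) v \<ge> 1"
    using vw by (auto simp: vdegree_def induced_subgraph_def Suc_le_eq card_gt_0_iff)
  also have "\<dots> \<le> max_degree (induced_subgraph G K)"
    unfolding max_degree_def using vw assms(1)
    by (intro Max_ge) (auto simp: induced_subgraph_def)
  finally show ?thesis .
qed

lemma card_indep_le_independence_number:
  assumes "finite (verts G)" "I \<subseteq> verts G" "indep I (edges G)"
  shows "card I \<le> independence_number G"
  unfolding independence_number_def
proof (rule Max_ge)
  have "{card I |I. I \<subseteq> verts G \<and> indep I (edges G)} \<subseteq> card ` Pow (verts G)"
    by auto
  then show "finite {card I |I. I \<subseteq> verts G \<and> indep I (edges G)}"
    using assms(1) by (meson finite_Pow_iff finite_imageI finite_subset)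
qed (use assms in auto)

text \<open>A set larger than every independent set contains an edge, so each value in the minimum
  is at least 1. One such set of maximum degree at most 1 therefore settles the sensitivity.\<close>

lemma sensitivity_eq_1:
  assumes fin: "finite (verts G)" and K: "K \<subseteq> verts G" "card K > independence_number G"
    and deg: "max_degree (induced_subgraph G K) \<le> 1"
  shows "max_degree (induced_subgraph G K) = 1" and "sensitivity G = 1"
proof -
  let ?D = "{max_degree (induced_subgraph G K) |K. K \<subseteq> verts G \<and> card K > independence_number G}"
  have ge: "max_degree (induced_subgraph G L) \<ge> 1"
    if "L \<subseteq> verts G" "card L > independence_number G" for L
    using that card_indep_le_independence_number[OF fin that(1)] fin
    by (intro max_degree_induced_ge_1) (auto intro: finite_subset)
  show eq: "max_degree (induced_subgraph G K) = 1"
    using ge[OF K] deg by simp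
  have "?D \<subseteq> (\<lambda>K. max_degree (induced_subgraph G K)) ` Pow (verts G)"
    by auto
  then have "finite ?D"
    using fin by (meson finite_Pow_iff finite_imageI finite_subset)
  then show "sensitivity G = 1"
    unfolding sensitivity_def
  proof (rule Min_eqI)
    show "1 \<le> d" if "d \<in> ?D" for d
      using that ge by blast
    show "1 \<in> ?D"
      using K eq by (metis (mono_tags, lifting) mem_Collect_eq)
  qed
qed

lemma independence_number_star_graph:
  assumes "n \<ge> 2"
  shows "2 * independence_number (star_graph n) \<le> card (verts (star_graph n))"
proof -
  let ?V = "verts (star_graph n)" and ?t = "\<lambda>x :: nat \<Rightarrow> nat. x \<circ> transpose 1 2"
  have fin: "finite ?V"
    by (simp add: verts_star_graph finite_permutations)
  have tV: "?t x \<in> ?V" if "x \<in> ?V" for x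
    using that assms by (auto simp: verts_star_graph intro!: permutes_compose permutes_swap_id)
  have edge: "{x, ?t x} \<in> edges (star_graph n)" if "x \<in> ?V" for x
    using star_graph_edge_iff[of x n "?t x"] that tV[OF that] assms
    by (auto simp: verts_star_graph)
  have tne: "?t x \<noteq> x" if "x \<in> ?V" for x
  proof
    assume "?t x = x"
    then have "?t x 1 = x 1" by simp
    then have "x 2 = x 1" by simp
    moreover have "inj x"
      using that permutes_inj by (auto simp: verts_star_graph)
    ultimately show False
      using injD[of x 2 1] by simp
  qed
  have inj: "inj ?t"
  proof (rule injI)
    fix x y :: "nat \<Rightarrow> nat"
    assume "?t x = ?t y"
    then have "?t (?t x) = ?t (?t y)" by simp
    then show "x = y" by (simp add: comp_assoc)
  qed
  have bound: "2 * card I \<le> card ?V" if I: "I \<subseteq> ?V" "indep I (edges (star_graph n))" for I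
  proof -
    have "?t x \<notin> I" if "x \<in> I" for x
    proof -
      have "x \<in> ?V" using that I(1) by blast
      from edge[OF this] tne[OF this] show ?thesis
        using I(2) that unfolding indep_def by metis
    qed
    \<comment> \<open>An independent set misses its set of partners under the matching, and
      \<open>?t\<close> is injective, so both fit side by side into the vertex set.\<close>
    then have "I \<inter> ?t ` I = {}"
      by blast
    moreover have "finite I"
      using I fin finite_subset by blast
    ultimately have "card (I \<union> ?t ` I) = 2 * card I"
      using card_image[OF inj_on_subset[OF inj subset_UNIV, of I]] by (simp add: card_Un_disjoint)
    moreover have "I \<union> ?t ` I \<subseteq> ?V"
      using I tV by blast
    ultimately show ?thesis
      using card_mono[OF fin] by metis
  qed
  let ?C = "{card I |I. I \<subseteq> ?V \<and> indep I (edges (star_graph n))}"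
  have "?C \<subseteq> card ` Pow ?V"
    by auto
  then have "finite ?C"
    using fin by (meson finite_Pow_iff finite_imageI finite_subset)
  \<comment> \<open>The empty set is independent, so the maximum is attained by an actual
    independent set and \<open>bound\<close> applies to it.\<close>
  moreover have "?C \<noteq> {}"
    using null_indep by blast
  ultimately have "independence_number (star_graph n) \<in> ?C"
    unfolding independence_number_def by (rule Max_in)
  then show ?thesis
    using bound by auto
qed

section \<open>The twisted sign and its level sets\<close>

text \<open>Flipping the sign on H turns the set K and its complement into the two level sets of one
  function, whose sum measures the difference of their sizes.\<close>

definition twisted_sign :: "nat \<Rightarrow> (nat \<Rightarrow> nat) \<Rightarrow> int" where
  "twisted_sign n x = (if \<exists>i\<in>{2..n}. x i = i then - sign x else sign x)"

lemma sum_twisted_sign: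
  assumes "n \<ge> 2"
  shows "(\<Sum>x | x permutes {1..n}. twisted_sign n x) = 2 * (- 1) ^ (n - 1)"
proof -
  let ?V = "{x. x permutes {1..n}}" and ?F = "{x. x permutes {1..n} \<and> (\<forall>i\<in>{2..n}. x i \<noteq> i)}"
  have fin: "finite ?V"
    by (simp add: finite_permutations)
  have "{1..n} - {2..n} = {1}"
    using assms by auto
  then have F: "(\<Sum>x\<in>?F. sign x) = (- 1) ^ (n - 1)"
    using sum_sign_no_fixpoint[of "{2..n}" "{1..n}"] by simp
  \<comment> \<open>The twisted sign is twice the sign restricted to the complement of H, minus the
    plain sign, which sums to zero.\<close>
  have "(\<Sum>x\<in>?V. twisted_sign n x) =
      (\<Sum>x\<in>?V. 2 * (if \<forall>i\<in>{2..n}. x i \<noteq> i then sign x else 0) - sign x)"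
    by (intro sum.cong) (auto simp: twisted_sign_def)
  also have "\<dots> = 2 * (\<Sum>x\<in>?V. if \<forall>i\<in>{2..n}. x i \<noteq> i then sign x else 0) - (\<Sum>x\<in>?V. sign x)"
    by (simp add: sum_subtractf sum_distrib_left)
  also have "(\<Sum>x\<in>?V. if \<forall>i\<in>{2..n}. x i \<noteq> i then sign x else 0) = (\<Sum>x\<in>?F. sign x)"
    using fin by (subst sum.inter_filter[symmetric]) auto
  also have "(\<Sum>x\<in>?V. sign x) = 0"
    using assms by (intro sum_sign_permutes) auto
  finally show ?thesis
    using F by simp
qed

lemma card_twisted_sign_class:
  assumes "n \<ge> 2"
  shows "2 * card {x. x permutes {1..n} \<and> twisted_sign n x = (- 1) ^ (n - 1)} >
    card {x. x permutes {1..n}}"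
proof -
  let ?V = "{x. x permutes {1..n}}" and ?e = "(- 1) ^ (n - 1) :: int"
  let ?K = "{x. x permutes {1..n} \<and> twisted_sign n x = ?e}"
  have fin: "finite ?V"
    by (simp add: finite_permutations)
  have e: "?e * (2 * ?e) = 2"
    by (simp flip: power_mult_distrib)
  \<comment> \<open>Both factors are 1 or -1, so the product is 1 on \<open>?K\<close> and -1 off
    it; summing gives \<open>card ?K\<close> minus the size of the complement.\<close>
  have "?e * twisted_sign n x = 2 * (if twisted_sign n x = ?e then 1 else 0) - 1" for x
    by (cases "even (n - 1)"; cases x rule: sign_cases) (auto simp: twisted_sign_def)
  then have "?e * (\<Sum>x\<in>?V. twisted_sign n x) =
      (\<Sum>x\<in>?V. 2 * (if twisted_sign n x = ?e then 1 else 0) - 1)"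
    by (simp add: sum_distrib_left)
  also have "\<dots> = 2 * (\<Sum>x\<in>?V. if twisted_sign n x = ?e then 1 else 0) - int (card ?V)"
    by (simp add: sum_subtractf sum_distrib_left)
  also have "(\<Sum>x\<in>?V. if twisted_sign n x = ?e then 1 else 0) = int (card ?K)"
    using fin by (subst sum.inter_filter[symmetric]) auto
  finally have "2 * int (card ?K) - int (card ?V) = 2"
    unfolding sum_twisted_sign[OF assms] e by simp
  then show ?thesis
    by linarith
qed

text \<open>The swap reverses the sign, so equal twisted signs force exactly one of the two
  permutations into H. Only the values at 1 and \<open>i\<close> change, hence \<open>i\<close> is
  where a fixed point is lost or gained. The right-hand side depends on \<open>x\<close> alone,
  which is what limits the degree.\<close>

lemma twisted_sign_swap:
  assumes x: "x permutes {1..n}" and i: "i \<in> {2..n}"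
    and eq: "twisted_sign n (x \<circ> transpose 1 i) = twisted_sign n x"
  shows "i = (if \<exists>j\<in>{2..n}. x j = j then THE j. j \<in> {2..n} \<and> x j = j else x 1)"
proof -
  let ?y = "x \<circ> transpose 1 i"
  have "permutation x"
    using x by (rule permutes_imp_permutation[rotated]) simp
  then have "sign ?y = - sign x"
    using i by (simp add: sign_compose sign_swap_id permutation_swap_id)
  then have iff: "(\<exists>j\<in>{2..n}. ?y j = j) \<longleftrightarrow> \<not> (\<exists>j\<in>{2..n}. x j = j)"
    using eq sign_nz[of x] by (auto simp: twisted_sign_def split: if_splits)
  have same: "?y j = x j" if "j \<in> {2..n}" "j \<noteq> i" for j
    using that by (simp add: transpose_def)
  show ?thesis
  proof (cases "\<exists>j\<in>{2..n}. x j = j")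
    case True
    then have only: "j = i" if "j \<in> {2..n}" "x j = j" for j
      using iff same that by metis
    with True have "(THE j. j \<in> {2..n} \<and> x j = j) = i"
      by (intro the_equality) auto
    with True show ?thesis by simp
  next
    case False
    then obtain j where "j \<in> {2..n}" "?y j = j"
      using iff by blast
    \<comment> \<open>The new fixed point can only be at \<open>i\<close>, where the swapped
      permutation takes the value \<open>x 1\<close>.\<close>
    with False same have "?y i = i" by metis
    with False show ?thesis by auto
  qed
qed

theorem theorem3p3:
  fixes n :: nat
  assumes "n \<ge> 2"
  shows "(\<exists>K \<subseteq> verts (star_graph n).
            2 * card K > card (verts (star_graph n)) \<and>
            max_degree (induced_subgraph (star_graph n) K) = 1)
         \<and> sensitivity (star_graph n) = 1"
proof -
  let ?G = "star_graph n"
  \<comment> \<open>The chosen value has the same sign as the total of all twisted signs, so this is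
    the larger level set.\<close>
  define K where "K = {x. x permutes {1..n} \<and> twisted_sign n x = (- 1) ^ (n - 1)}"
  have fin: "finite (verts ?G)"
    by (simp add: verts_star_graph finite_permutations)
  have sub: "K \<subseteq> verts ?G"
    by (auto simp: K_def verts_star_graph)
  have big: "2 * card K > card (verts ?G)"
    using card_twisted_sign_class[OF assms] by (simp add: K_def verts_star_graph)
  have "vdegree (induced_subgraph ?G K) x \<le> 1" if x: "x \<in> K" for x
  proof -
    let ?f = "if \<exists>j\<in>{2..n}. x j = j then THE j. j \<in> {2..n} \<and> x j = j else x 1"
    have "y = x \<circ> transpose 1 ?f" if y: "y \<in> K" "{x, y} \<in> edges ?G" for y
    proof -
      have perm: "x permutes {1..n}" "y permutes {1..n}"
        and eq: "twisted_sign n y = twisted_sign n x"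
        using x y by (simp_all add: K_def)
      obtain i where i: "i \<in> {2..n}" "y = x \<circ> transpose 1 i"
        using y(2) star_graph_edge_iff[OF perm] by blast
      have "i = ?f"
        using twisted_sign_swap[OF perm(1) i(1)] eq i(2) by blast
      then show ?thesis
        using i(2) by (rule subst)
    qed
    \<comment> \<open>Since \<open>?f\<close> does not mention \<open>y\<close>, all neighbours of
      \<open>x\<close> within \<open>K\<close> coincide.\<close>
    then have "{y \<in> K. {x, y} \<in> edges ?G \<and> {x, y} \<subseteq> K} \<subseteq> {x \<circ> transpose 1 ?f}"
      by blast
    then have "card {y \<in> K. {x, y} \<in> edges ?G \<and> {x, y} \<subseteq> K} \<le> card {x \<circ> transpose 1 ?f}"
      by (intro card_mono) auto
    then show ?thesis
      by (simp add: vdegree_def induced_subgraph_def)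
  qed
  moreover have "finite K" "K \<noteq> {}"
    using sub fin big by (auto intro: finite_subset)
  ultimately have deg: "max_degree (induced_subgraph ?G K) \<le> 1"
    unfolding max_degree_def by (subst Max_le_iff) (auto simp: induced_subgraph_def)
  have "card K > independence_number ?G"
    using big independence_number_star_graph[OF assms] by linarith
  from sensitivity_eq_1[OF fin sub this deg] show ?thesis
    using sub big by blast
qed

end
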